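(* Let $\mu,\tau\in\mathbb{R}_+$, $\alpha\in(0,1]$ and $x\in\mathcal{X}$. Then each of the constraints $$\mathbb{E}\left[\psi_s^{\mu,\tau}(f(x,\Xi))\right]\le\alpha \qquad\text{and}\qquad \mathbb{E}\left[\psi_{ss}^{\mu,\tau}(f(x,\Xi))\right]\le\alpha$$ is a conservative approximation of the chance constraint $\mathbb{P}(f(x,\Xi)\le 0)\ge 1-\alpha$; that is, if either one of these two constraints holds at $x$, then $\mathbb{P}(f(x,\Xi)\le 0)\ge 1-\alpha$.
   Context: $(\Omega,\mathcal{F},\mathbb{P})$ is a probability space and $\Xi:\Omega\to\mathbb{R}^d$ is a random vector. $\mathcal{X}=\{x\in\mathbb{R}^n : g(x)\ge 0\}$ is nonempty and compact, with $g:\mathbb{R}^n\to\mathbb{R}^m$ twice differentiable. The scalar constraint function $f(x,\xi)$, $x\in\mathbb{R}^n$, $\xi\in\mathbb{R}^d$, is real-valued and twice continuously differentiable, and $f(x,\Xi)$ is the resulting scalar random variable. Write $[a]_+:=\max\{a,0\}$. The standard sigmoid function is $$\psi_s^{\mu,\tau}(z):=\frac{1+\mu}{\mu+e^{-\tau z}},\qquad z\in\mathbb{R},$$ and its tailored variant is $$\psi_{ss}^{\mu,\tau}(z):=\left[2\,\frac{1+\mu}{\mu+e^{-\tau z}}-1\right]_+,\qquad z\in\mathbb{R}.$$ Both functions are nonnegative, so the expectations are well defined in $[0,\infty]$. *)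

theory Defs
  imports "HOL-Probability.Probability"
begin

text \<open>
  Derivatives are total (Frechet) derivatives on the whole space. The first derivative is a map
  into the normed space of bounded linear maps, and so can be differentiated again.
\<close>

definition twice_differentiable ::
    "('a::real_normed_vector \<Rightarrow> 'b::real_normed_vector) \<Rightarrow> bool" where
  "twice_differentiable h \<longleftrightarrow>
     (\<exists>h' :: 'a \<Rightarrow> 'a \<Rightarrow>\<^sub>L 'b. \<exists>h'' :: 'a \<Rightarrow> 'a \<Rightarrow>\<^sub>L 'a \<Rightarrow>\<^sub>L 'b.
        (\<forall>x. (h has_derivative blinfun_apply (h' x)) (at x)) \<and>
        (\<forall>x. (h' has_derivative blinfun_apply (h'' x)) (at x)))"

definition twice_continuously_differentiable ::
    "('a::real_normed_vector \<Rightarrow> 'b::real_normed_vector) \<Rightarrow> bool" where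
  "twice_continuously_differentiable h \<longleftrightarrow>
     (\<exists>h' :: 'a \<Rightarrow> 'a \<Rightarrow>\<^sub>L 'b. \<exists>h'' :: 'a \<Rightarrow> 'a \<Rightarrow>\<^sub>L 'a \<Rightarrow>\<^sub>L 'b.
        (\<forall>x. (h has_derivative blinfun_apply (h' x)) (at x)) \<and>
        (\<forall>x. (h' has_derivative blinfun_apply (h'' x)) (at x)) \<and>
        continuous_on UNIV h'')"

definition feasible_set :: "(real ^ 'n \<Rightarrow> real ^ 'm) \<Rightarrow> (real ^ 'n) set" where
  "feasible_set g = {x. \<forall>i. g x $ i \<ge> 0}"

definition pos_part :: "real \<Rightarrow> real" where
  "pos_part a = max a 0"

definition sigmoid :: "real \<Rightarrow> real \<Rightarrow> real \<Rightarrow> real" where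
  "sigmoid \<mu> \<tau> z = (1 + \<mu>) / (\<mu> + exp (- \<tau> * z))"

definition tailored_sigmoid :: "real \<Rightarrow> real \<Rightarrow> real \<Rightarrow> real" where
  "tailored_sigmoid \<mu> \<tau> z = pos_part (2 * ((1 + \<mu>) / (\<mu> + exp (- \<tau> * z))) - 1)"

text \<open>
  Expectation in $[0,\infty]$. Since \<^const>\<open>ennreal\<close> sends negative reals to 0, this is meant
  only for nonnegative random variables.
\<close>

definition expectation_nn :: "'w measure \<Rightarrow> ('w \<Rightarrow> real) \<Rightarrow> ennreal" where
  "expectation_nn M Y = (\<integral>\<^sup>+ \<omega>. ennreal (Y \<omega>) \<partial>M)"

end

theory Submission
  imports Defs
begin

text \<open>
  For $\tau \ge 0$ and $z > 0$ the denominator $\mu + e^{-\tau z}$ is positive and at most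
  $1 + \mu$, so both sigmoids are at least 1 on the positive half-line. They therefore dominate
  the indicator of the violation event $\{f(x,\Xi) > 0\}$ wherever it is nonzero, and by
  nonnegativity (\<^const>\<open>ennreal\<close> has no negative values) everywhere else. Taking expectations,
  the probability of violation is at most $\alpha$, and passing to the complement gives the
  chance constraint. The violation event is measurable because the smooth function $f$
  is continuous in $\xi$.
\<close>

lemma sigmoid_ge_1:
  assumes "\<mu> \<ge> 0" "\<tau> \<ge> 0" "z \<ge> 0"
  shows "1 \<le> sigmoid \<mu> \<tau> z"
proof -
  have "exp (- \<tau> * z) \<le> 1"
    using assms by simp
  moreover have "0 < \<mu> + exp (- \<tau> * z)"
    using assms by (simp add: add_nonneg_pos)
  ultimately show ?thesis
    by (simp add: sigmoid_def le_divide_eq)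
qed

text \<open>
  The map $s \mapsto [2s - 1]_+$ that turns the sigmoid into its tailored variant preserves
  the bound $s \ge 1$.
\<close>

lemma tailored_sigmoid_ge_1:
  assumes "\<mu> \<ge> 0" "\<tau> \<ge> 0" "z \<ge> 0"
  shows "1 \<le> tailored_sigmoid \<mu> \<tau> z"
  using sigmoid_ge_1[OF assms]
  unfolding tailored_sigmoid_def sigmoid_def pos_part_def by linarith

text \<open>
  Markov's inequality at level 1 for the event $Y > 0$, followed by passage to the complement.
  The integral of $[h]_+$ is the supremum of the integrals of the simple functions below it,
  and the indicator of the event is one of them.
\<close>

lemma prob_nonpos_ge_if_dominated:
  assumes "prob_space M" and Y: "Y \<in> borel_measurable M"
    and dom: "\<And>\<omega>. \<omega> \<in> space M \<Longrightarrow> 0 < Y \<omega> \<Longrightarrow> 1 \<le> h \<omega>"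
    and h: "expectation_nn M h \<le> ennreal \<alpha>" and "0 \<le> \<alpha>"
  shows "1 - \<alpha> \<le> \<P>(\<omega> in M. Y \<omega> \<le> (0::real))"
proof -
  interpret prob_space M by fact
  let ?V = "{\<omega> \<in> space M. 0 < Y \<omega>}"
  have V: "?V \<in> sets M"
    using Y by measurable
  have "emeasure M ?V = (\<integral>\<^sup>+ \<omega>. indicator ?V \<omega> \<partial>M)"
    using V by simp
  also have "\<dots> \<le> expectation_nn M h"
    unfolding expectation_nn_def
    by (rule nn_integral_mono) (auto simp: indicator_def dom)
  finally have "prob ?V \<le> \<alpha>"
    using h \<open>0 \<le> \<alpha>\<close> by (metis emeasure_eq_measure ennreal_le_iff order_trans)
  moreover have "{\<omega> \<in> space M. Y \<omega> \<le> 0} = space M - ?V"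
    by auto
  ultimately show ?thesis
    using prob_compl[OF V] by simp
qed

lemma twice_continuously_differentiable_imp_continuous_section:
  assumes "twice_continuously_differentiable (\<lambda>(y, \<xi>). f y \<xi>)"
  shows "continuous_on UNIV (f x)"
proof -
  have "continuous_on UNIV (\<lambda>(y, \<xi>). f y \<xi>)"
    using assms unfolding twice_continuously_differentiable_def
    by (meson continuous_at_imp_continuous_on has_derivative_continuous)
  then have "continuous_on UNIV (\<lambda>\<xi>. (\<lambda>(y, \<xi>). f y \<xi>) (x, \<xi>))"
    by (rule continuous_on_compose2) (auto intro: continuous_intros)
  then show ?thesis
    by simp
qed

theorem lemma1:
  fixes M :: "'w measure"
    and \<Xi> :: "'w \<Rightarrow> real ^ 'd"
    and g :: "real ^ 'n \<Rightarrow> real ^ 'm"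
    and f :: "real ^ 'n \<Rightarrow> real ^ 'd \<Rightarrow> real"
    and \<mu> \<tau> \<alpha> :: real
    and x :: "real ^ 'n"
  assumes "prob_space M"
    and "\<Xi> \<in> borel_measurable M"
    and "twice_differentiable g"
    and "feasible_set g \<noteq> {}"
    and "compact (feasible_set g)"
    and "twice_continuously_differentiable (\<lambda>(y, \<xi>). f y \<xi>)"
    and "\<mu> \<ge> 0"
    and "\<tau> \<ge> 0"
    and "0 < \<alpha>"
    and "\<alpha> \<le> 1"
    and "x \<in> feasible_set g"
  shows "(expectation_nn M (\<lambda>\<omega>. sigmoid \<mu> \<tau> (f x (\<Xi> \<omega>))) \<le> ennreal \<alpha>
            \<longrightarrow> \<P>(\<omega> in M. f x (\<Xi> \<omega>) \<le> 0) \<ge> 1 - \<alpha>) \<and>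
         (expectation_nn M (\<lambda>\<omega>. tailored_sigmoid \<mu> \<tau> (f x (\<Xi> \<omega>))) \<le> ennreal \<alpha>
            \<longrightarrow> \<P>(\<omega> in M. f x (\<Xi> \<omega>) \<le> 0) \<ge> 1 - \<alpha>)"
proof -
  have "f x \<in> borel_measurable borel"
    using assms(6) twice_continuously_differentiable_imp_continuous_section
      borel_measurable_continuous_onI by blast
  then have Y: "(\<lambda>\<omega>. f x (\<Xi> \<omega>)) \<in> borel_measurable M"
    using assms(2) by (rule measurable_compose[rotated])
  note chance = prob_nonpos_ge_if_dominated[OF assms(1) Y _ _ less_imp_le[OF assms(9)]]
  show ?thesis
  proof (intro conjI impI)
    assume "expectation_nn M (\<lambda>\<omega>. sigmoid \<mu> \<tau> (f x (\<Xi> \<omega>))) \<le> ennreal \<alpha>"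
    then show "\<P>(\<omega> in M. f x (\<Xi> \<omega>) \<le> 0) \<ge> 1 - \<alpha>"
      by (rule chance[rotated]) (simp add: sigmoid_ge_1 assms(7,8))
  next
    assume "expectation_nn M (\<lambda>\<omega>. tailored_sigmoid \<mu> \<tau> (f x (\<Xi> \<omega>))) \<le> ennreal \<alpha>"
    then show "\<P>(\<omega> in M. f x (\<Xi> \<omega>) \<le> 0) \<ge> 1 - \<alpha>"
      by (rule chance[rotated]) (simp add: tailored_sigmoid_ge_1 assms(7,8))
  qed
qed

end
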